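(* Let $\alpha$ be an order function with dual function $\beta$, and consider an indeterminate normalized Hamburger moment problem with orthonormal polynomials $P_n$, polynomials of the second kind $Q_n$ and recurrence coefficients $a_n\in\mathbb R$, $b_n>0$. The following conditions are equivalent: (i) $\beta(P_n^2(0)),\beta(Q_n^2(0))\in\ell^1$; (ii) $\beta(|P_n(z)|^2),\beta(|Q_n(z)|^2)\in\ell^1$ for all $z\in\mathbb C$. If the conditions are satisfied, then the two series $\sum_n\beta(|P_n(z)|^2)$ and $\sum_n\beta(|Q_n(z)|^2)$ converge uniformly on compact subsets of $\mathbb C$. Furthermore, $\beta(1/b_n)\in\ell^1$ and the function $P$ has order bounded by $\alpha$.
   Context: An order function is a continuous, positive and increasing function $\alpha:(r_0,\infty)\to\mathbb R$, where $0\le r_0<\infty$, with $\lim_{r\to\infty}\alpha(r)=\infty$ and such that $r/\alpha(r)$ is also increasing with $\lim_{r\to\infty}r/\alpha(r)=\infty$. Its dual function is $\beta(r)=1/\alpha(r^{-1})$ for $0<r<r_0^{-1}$ (with $0^{-1}=\infty$), and $\beta(0)=0$. For a sequence $u_n\ge0$ tending to zero, $\beta(u_n)$ is defined only for sufficiently large $n$; $\beta(u_n)\in\ell^1$ means $\sum_{n\ge N}\beta(u_n)<\infty$ for one (equivalently every) $N$ so large that $\beta(u_n)$ is defined for $n\ge N$. Likewise, uniform convergence on a compact set is understood for the series started at a sufficiently large index (depending on the compact set). A continuous unbounded $f:\mathbb C\to\mathbb C$ has order bounded by $\alpha$ if there is a constant $K$ with $M_f(r)\le r^{K\alpha(r)}$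 for all sufficiently large $r$, where $M_f(r)=\max_{|z|\le r}|f(z)|$. A normalized Hamburger moment problem is given by a sequence $s_n=\int_{-\infty}^\infty x^n\,d\mu(x)$, $n\ge0$, where $\mu$ is a probability measure on $\mathbb R$ with infinite support and moments of every order. It is indeterminate if more than one measure $\mu$ has these moments. The orthonormal polynomials $P_n$ and polynomials of the second kind $Q_n$ are solutions of $$z r_n(z)=b_nr_{n+1}(z)+a_nr_n(z)+b_{n-1}r_{n-1}(z),\quad n\ge0,$$ with $a_n\in\mathbb R$, $b_n>0$ for $n\ge0$, $b_{-1}=1$, and initial conditions $P_0=1$, $P_{-1}=0$, $Q_0=0$, $Q_{-1}=-1$. Put $P(z)=(\sum_{n\ge0}|P_n(z)|^2)^{1/2}$. In the indeterminate case $P$ and $(\sum_n|Q_n(z)|^2)^{1/2}$ are finite and continuous on $\mathbb C$, and $\sum 1/b_n<\infty$. *)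

theory Defs
  imports "HOL-Probability.Probability" "HOL-Computational_Algebra.Polynomial"
begin

text \<open>
  The function \<open>\<alpha>\<close> lives on \<open>(r0,\<infinity>)\<close>; its values elsewhere are irrelevant.
  ``Increasing'' is read in the weak sense, both for \<open>\<alpha>\<close> and for \<open>r/\<alpha>(r)\<close>.
\<close>

definition order_function :: "real \<Rightarrow> (real \<Rightarrow> real) \<Rightarrow> bool" where
  "order_function r0 \<alpha> \<longleftrightarrow>
     0 \<le> r0 \<and>
     continuous_on {r0<..} \<alpha> \<and>
     (\<forall>r>r0. 0 < \<alpha> r) \<and>
     mono_on {r0<..} \<alpha> \<and>
     filterlim \<alpha> at_top at_top \<and>
     mono_on {r0<..} (\<lambda>r. r / \<alpha> r) \<and>
     filterlim (\<lambda>r. r / \<alpha> r) at_top at_top"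

text \<open>
  The interval \<open>[0, 1/r0)\<close> on which the dual function is defined, with \<open>1/0 = \<infinity>\<close>;
  hence the product form of \<open>r < 1/r0\<close>.
\<close>

definition dual_domain :: "real \<Rightarrow> real set" where
  "dual_domain r0 = {r. 0 \<le> r \<and> r * r0 < 1}"

definition dual_function :: "(real \<Rightarrow> real) \<Rightarrow> real \<Rightarrow> real" where
  "dual_function \<alpha> r = (if r = 0 then 0 else 1 / \<alpha> (1 / r))"

definition dual_in_l1 :: "real \<Rightarrow> (real \<Rightarrow> real) \<Rightarrow> (nat \<Rightarrow> real) \<Rightarrow> bool" where
  "dual_in_l1 r0 \<alpha> u \<longleftrightarrow>
     (\<exists>N. (\<forall>n\<ge>N. u n \<in> dual_domain r0) \<and> summable (\<lambda>n. dual_function \<alpha> (u (n + N))))"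

definition dual_series_uniformly_convergent_on ::
  "real \<Rightarrow> (real \<Rightarrow> real) \<Rightarrow> complex set \<Rightarrow> (nat \<Rightarrow> complex \<Rightarrow> real) \<Rightarrow> bool" where
  "dual_series_uniformly_convergent_on r0 \<alpha> C u \<longleftrightarrow>
     (\<exists>N. (\<forall>n\<ge>N. \<forall>z\<in>C. u n z \<in> dual_domain r0) \<and>
          uniformly_convergent_on C (\<lambda>m z. \<Sum>n<m. dual_function \<alpha> (u (n + N) z)))"

definition max_modulus :: "(complex \<Rightarrow> complex) \<Rightarrow> real \<Rightarrow> real" where
  "max_modulus f r = (SUP z\<in>cball 0 r. cmod (f z))"

definition has_order_bounded_by :: "(complex \<Rightarrow> complex) \<Rightarrow> (real \<Rightarrow> real) \<Rightarrow> bool" where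
  "has_order_bounded_by f \<alpha> \<longleftrightarrow>
     continuous_on UNIV f \<and> \<not> bounded (range f) \<and>
     (\<exists>K::real. \<forall>\<^sub>F r in at_top. max_modulus f r \<le> r powr (K * \<alpha> r))"

definition has_moments :: "real measure \<Rightarrow> (nat \<Rightarrow> real) \<Rightarrow> bool" where
  "has_moments \<mu> s \<longleftrightarrow>
     sets \<mu> = sets borel \<and> (\<forall>n. has_bochner_integral \<mu> (\<lambda>x. x ^ n) (s n))"

definition measure_support :: "real measure \<Rightarrow> real set" where
  "measure_support \<mu> = {x. \<forall>U. open U \<longrightarrow> x \<in> U \<longrightarrow> 0 < emeasure \<mu> U}"

definition normalized_hamburger :: "real measure \<Rightarrow> (nat \<Rightarrow> real) \<Rightarrow> bool" where
  "normalized_hamburger \<mu> s \<longleftrightarrow>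
     has_moments \<mu> s \<and> prob_space \<mu> \<and> infinite (measure_support \<mu>)"

definition indeterminate :: "(nat \<Rightarrow> real) \<Rightarrow> bool" where
  "indeterminate s \<longleftrightarrow> (\<exists>\<mu> \<nu>. has_moments \<mu> s \<and> has_moments \<nu> s \<and> \<mu> \<noteq> \<nu>)"

definition orthonormal_polynomials :: "real measure \<Rightarrow> (nat \<Rightarrow> real poly) \<Rightarrow> bool" where
  "orthonormal_polynomials \<mu> P \<longleftrightarrow>
     (\<forall>n. degree (P n) = n \<and> 0 < lead_coeff (P n)) \<and>
     (\<forall>m n. (\<integral>x. poly (P m) x * poly (P n) x \<partial>\<mu>) = (if m = n then 1 else 0))"

text \<open>
  \<open>three_term_recurrence a b q r\<close> says that
  \<open>z r\<^sub>n = b\<^sub>n r\<^sub>n\<^sub>+\<^sub>1 + a\<^sub>n r\<^sub>n + b\<^sub>n\<^sub>-\<^sub>1 r\<^sub>n\<^sub>-\<^sub>1\<close> for all \<open>n \<ge> 0\<close>, as an identity of polynomials in \<open>z\<close>,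
  where \<open>q\<close> stands for \<open>r\<^sub>-\<^sub>1\<close> and \<open>b\<^sub>-\<^sub>1 = 1\<close>.
\<close>

definition three_term_recurrence ::
  "(nat \<Rightarrow> real) \<Rightarrow> (nat \<Rightarrow> real) \<Rightarrow> real poly \<Rightarrow> (nat \<Rightarrow> real poly) \<Rightarrow> bool" where
  "three_term_recurrence a b q r \<longleftrightarrow>
     (\<forall>n. [:0, 1:] * r n =
        smult (b n) (r (Suc n)) + smult (a n) (r n) +
        (case n of 0 \<Rightarrow> q | Suc m \<Rightarrow> smult (b m) (r m)))"

definition cpoly :: "real poly \<Rightarrow> complex \<Rightarrow> complex" where
  "cpoly p z = poly (map_poly complex_of_real p) z"

text \<open>The series converges for every \<open>z\<close> in the indeterminate case.\<close>

definition P_function :: "(nat \<Rightarrow> real poly) \<Rightarrow> complex \<Rightarrow> real" where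
  "P_function P z = sqrt (\<Sum>n. (cmod (cpoly (P n) z))\<^sup>2)"

end

theory Submission
  imports Defs
begin

text \<open>
  Put \<open>u\<^sub>n = P\<^sub>n(0)\<^sup>2 + Q\<^sub>n(0)\<^sup>2\<close>. Since \<open>\<beta>(u) \<ge> u\<close> for small \<open>u\<close>, condition (i) already forces
  \<open>\<Sum> u\<^sub>n < \<infinity>\<close>. A solution \<open>r\<^sub>n\<close> of the recurrence at \<open>z\<close> is written by variation of constants as
  \<open>r\<^sub>n = A\<^sub>n P\<^sub>n(0) + B\<^sub>n Q\<^sub>n(0)\<close>, where \<open>A\<^sub>n\<close> and \<open>B\<^sub>n\<close> are the Wronskians of \<open>r\<close> with \<open>Q(0)\<close> and \<open>P(0)\<close>.
  Each step changes \<open>(A, B)\<close> by a rank one matrix of norm \<open>|z| u\<^sub>n\<close>, so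
  \<open>|r\<^sub>n|\<^sup>2 \<le> u\<^sub>n \<Prod>\<^sub>k\<^sub>\<le>\<^sub>n (1 + |z| u\<^sub>k)\<^sup>2\<close>. On a compact set this is at most \<open>c u\<^sub>n\<close> with \<open>c \<ge> 1\<close>, and
  \<open>\<beta>(c u) \<le> c \<beta>(u)\<close> because \<open>\<beta>(u)/u\<close> is decreasing; this gives (ii) and the uniform convergence.
  The coefficient \<open>1/b\<^sub>n\<close> is the Wronskian of \<open>P(0)\<close> and \<open>Q(0)\<close>, hence at most \<open>u\<^sub>n + u\<^sub>n\<^sub>+\<^sub>1\<close>, and \<open>\<beta>\<close> is
  subadditive. For the order of \<open>P\<close> one bounds \<open>ln (1 + r u)\<close> by \<open>2 \<alpha>(r) \<beta>(u) ln r\<close> and sums over \<open>u = u\<^sub>k\<close>.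
\<close>

section \<open>The dual function: monotonicity and subadditivity\<close>

lemma mem_dual_domain_iff:
  assumes "0 \<le> r0" "0 < u"
  shows "u \<in> dual_domain r0 \<longleftrightarrow> r0 < 1 / u"
  using assms by (auto simp: dual_domain_def field_simps)

lemma dual_domain_downward:
  assumes "0 \<le> r0" "0 \<le> u" "u \<le> v" "v \<in> dual_domain r0"
  shows "u \<in> dual_domain r0"
  using assms mult_right_mono[of u v r0] by (auto simp: dual_domain_def)

lemma dual_function_pos:
  assumes "order_function r0 \<alpha>" "u \<in> dual_domain r0" "0 < u"
  shows "0 < dual_function \<alpha> u"
  using assms mem_dual_domain_iff[of r0 u] by (auto simp: order_function_def dual_function_def)

lemma dual_function_nonneg:
  assumes "order_function r0 \<alpha>" "u \<in> dual_domain r0"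
  shows "0 \<le> dual_function \<alpha> u"
  using dual_function_pos[OF assms] assms(2)
  by (cases "u = 0") (auto simp: dual_domain_def dual_function_def)

lemma dual_function_mono:
  assumes "order_function r0 \<alpha>" "0 \<le> u" "u \<le> v" "v \<in> dual_domain r0"
  shows "dual_function \<alpha> u \<le> dual_function \<alpha> v"
proof (cases "u = 0")
  case True
  then show ?thesis
    using dual_function_nonneg[OF assms(1,4)] by (simp add: dual_function_def)
next
  case False
  have r0: "0 \<le> r0" and pos: "\<And>r. r0 < r \<Longrightarrow> 0 < \<alpha> r" and mono: "mono_on {r0<..} \<alpha>"
    using assms(1) by (auto simp: order_function_def)
  have uv: "0 < u" "0 < v" using False assms by auto
  have v: "r0 < 1 / v" using mem_dual_domain_iff[OF r0 uv(2)] assms(4) by simp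
  have vu: "1 / v \<le> 1 / u" using uv assms(3) by (simp add: frac_le)
  have "\<alpha> (1 / v) \<le> \<alpha> (1 / u)"
    using mono_onD[OF mono _ _ vu] v vu by auto
  then show ?thesis using uv pos[OF v] by (simp add: dual_function_def frac_le)
qed

text \<open>At r = 1/u the quotient r/\<alpha>(r) equals \<beta>(u)/u, so its monotonicity becomes,
  under the inversion, that \<beta>(u)/u decreases; the form here is cross-multiplied.\<close>

lemma dual_function_ratio_antimono:
  assumes "order_function r0 \<alpha>" "0 < u" "u \<le> v" "v \<in> dual_domain r0"
  shows "u * dual_function \<alpha> v \<le> v * dual_function \<alpha> u"
proof -
  have r0: "0 \<le> r0" and pos: "\<And>r. r0 < r \<Longrightarrow> 0 < \<alpha> r"
    and mono: "mono_on {r0<..} (\<lambda>r. r / \<alpha> r)"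
    using assms(1) by (auto simp: order_function_def)
  have uv: "0 < u" "0 < v" using assms by auto
  have v: "r0 < 1 / v" using mem_dual_domain_iff[OF r0 uv(2)] assms(4) by simp
  have vu: "1 / v \<le> 1 / u" using uv assms(3) by (simp add: frac_le)
  have "(1 / v) / \<alpha> (1 / v) \<le> (1 / u) / \<alpha> (1 / u)"
    using mono_onD[OF mono _ _ vu] v vu by auto
  then have "(u * v) * ((1 / v) / \<alpha> (1 / v)) \<le> (u * v) * ((1 / u) / \<alpha> (1 / u))"
    using uv by (intro mult_left_mono) auto
  then show ?thesis using uv by (simp add: dual_function_def)
qed

text \<open>Because \<beta>(u)/u decreases, u \<beta>(u+v) \<le> (u+v) \<beta>(u), and likewise for
  v; add the two and divide by u+v.\<close>

lemma dual_function_add: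
  assumes "order_function r0 \<alpha>" "0 \<le> u" "0 \<le> v" "u + v \<in> dual_domain r0"
  shows "dual_function \<alpha> (u + v) \<le> dual_function \<alpha> u + dual_function \<alpha> v"
proof (cases "u = 0 \<or> v = 0")
  case True
  then show ?thesis by (auto simp: dual_function_def)
next
  case False
  then have uv: "0 < u" "0 < v" using assms by auto
  have "u * dual_function \<alpha> (u + v) \<le> (u + v) * dual_function \<alpha> u"
       "v * dual_function \<alpha> (u + v) \<le> (u + v) * dual_function \<alpha> v"
    using uv by (auto intro!: dual_function_ratio_antimono[OF assms(1) _ _ assms(4)])
  then have "(u + v) * dual_function \<alpha> (u + v)
      \<le> (u + v) * (dual_function \<alpha> u + dual_function \<alpha> v)"
    by (simp add: algebra_simps)
  then show ?thesis using uv by simp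
qed

lemma dual_function_mult:
  assumes "order_function r0 \<alpha>" "1 \<le> c" "0 \<le> u" "c * u \<in> dual_domain r0"
  shows "dual_function \<alpha> (c * u) \<le> c * dual_function \<alpha> u"
proof (cases "u = 0")
  case True
  then show ?thesis by (auto simp: dual_function_def)
next
  case False
  then have u: "0 < u" using assms by auto
  have "u * dual_function \<alpha> (c * u) \<le> (c * u) * dual_function \<alpha> u"
    using u assms(2) by (intro dual_function_ratio_antimono[OF assms(1) _ _ assms(4)]) auto
  then have "u * dual_function \<alpha> (c * u) \<le> u * (c * dual_function \<alpha> u)"
    by (simp add: algebra_simps)
  then show ?thesis using u by simp
qed

section \<open>Summability of \<beta>(u_n) and domination\<close>

text \<open>The start index disappears: only finitely many terms can lie outside the domain, and
  their arbitrary values do not affect summability.\<close>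

lemma dual_in_l1_iff:
  "dual_in_l1 r0 \<alpha> u \<longleftrightarrow>
     (\<forall>\<^sub>F n in sequentially. u n \<in> dual_domain r0) \<and> summable (\<lambda>n. dual_function \<alpha> (u n))"
  unfolding dual_in_l1_def eventually_sequentially
  using summable_iff_shift[of "\<lambda>n. dual_function \<alpha> (u n)"] by blast

lemma eventually_in_dual_domain:
  assumes "w \<longlonglongrightarrow> 0" "\<And>n. 0 \<le> w n"
  shows "\<forall>\<^sub>F n in sequentially. w n \<in> dual_domain r0"
proof -
  have "(\<lambda>n. w n * r0) \<longlonglongrightarrow> 0" using tendsto_mult_left_zero[OF assms(1)] .
  then have "\<forall>\<^sub>F n in sequentially. w n * r0 < 1" by (rule order_tendstoD) simp
  then show ?thesis by eventually_elim (use assms(2) in \<open>auto simp: dual_domain_def\<close>)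
qed

text \<open>Convergence of u_n to 0 is not assumed but recovered: \<beta>(u_n) tends to 0, so
  \<alpha>(1/u_n) and hence 1/u_n becomes large whenever u_n > 0. There r/\<alpha>(r) \<ge> 1, which
  at r = 1/u_n says u_n \<le> \<beta>(u_n).\<close>

lemma dual_in_l1_imp_summable:
  assumes "order_function r0 \<alpha>" "dual_in_l1 r0 \<alpha> u"
  shows "summable u"
proof -
  have r0: "0 \<le> r0" and pos: "\<And>r. r0 < r \<Longrightarrow> 0 < \<alpha> r" and mono: "mono_on {r0<..} \<alpha>"
    and lim: "filterlim (\<lambda>r. r / \<alpha> r) at_top at_top"
    using assms(1) by (auto simp: order_function_def)
  have sm: "summable (\<lambda>n. dual_function \<alpha> (u n))"
    and dom: "\<forall>\<^sub>F n in sequentially. u n \<in> dual_domain r0"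
    using assms(2) by (auto simp: dual_in_l1_iff)
  have "\<forall>\<^sub>F r in at_top. 1 \<le> r / \<alpha> r" using lim by (auto simp: filterlim_at_top)
  then obtain R' where R': "\<And>r. R' \<le> r \<Longrightarrow> 1 \<le> r / \<alpha> r"
    by (auto simp: eventually_at_top_linorder)
  \<comment> \<open>The maximum with \<open>r0 + 1\<close> puts \<open>R\<close> inside the open
    domain of \<alpha>, so that \<alpha>(R) > 0.\<close>
  define R where "R = max R' (r0 + 1)"
  have R: "r0 < R" "\<And>r. R \<le> r \<Longrightarrow> 1 \<le> r / \<alpha> r" using R' by (auto simp: R_def)
  have "\<forall>\<^sub>F n in sequentially. dual_function \<alpha> (u n) < 1 / \<alpha> R"
    using summable_LIMSEQ_zero[OF sm] pos[OF R(1)] by (intro order_tendstoD) auto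
  then have "\<forall>\<^sub>F n in sequentially. norm (u n) \<le> dual_function \<alpha> (u n)"
    using dom
  proof eventually_elim
    case (elim n)
    show ?case
    proof (cases "u n = 0")
      case False
      then have un: "0 < u n" using elim by (auto simp: dual_domain_def)
      then have d: "r0 < 1 / u n" using mem_dual_domain_iff r0 elim by blast
      have ap: "0 < \<alpha> (1 / u n)" using pos d by blast
      have "\<alpha> R < \<alpha> (1 / u n)"
        using elim un ap pos[OF R(1)] by (simp add: dual_function_def field_simps)
      then have "R \<le> 1 / u n"
        using mono_onD[OF mono, of "1 / u n" R] d R(1) by fastforce
      then have "1 \<le> (1 / u n) / \<alpha> (1 / u n)" using R(2) by blast
      then show ?thesis using un ap by (simp add: dual_function_def field_simps)
    qed (simp add: dual_function_def)
  qed
  then show ?thesis by (rule summable_comparison_test_ev[OF _ sm])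
qed

lemma dual_in_l1_Suc:
  assumes "dual_in_l1 r0 \<alpha> u"
  shows "dual_in_l1 r0 \<alpha> (\<lambda>n. u (Suc n))"
  using assms unfolding dual_in_l1_iff
  by (simp add: summable_Suc_iff[of "\<lambda>n. dual_function \<alpha> (u n)"]
      eventually_sequentially_Suc[of "\<lambda>n. u n \<in> dual_domain r0"])

lemma dual_in_l1_add:
  assumes o: "order_function r0 \<alpha>" and u: "dual_in_l1 r0 \<alpha> u" and v: "dual_in_l1 r0 \<alpha> v"
    and nn: "\<And>n. 0 \<le> u n" "\<And>n. 0 \<le> v n"
  shows "dual_in_l1 r0 \<alpha> (\<lambda>n. u n + v n)"
proof -
  have "(\<lambda>n. u n + v n) \<longlonglongrightarrow> 0"
    by (intro summable_LIMSEQ_zero summable_add dual_in_l1_imp_summable[OF o] u v)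
  then have dom: "\<forall>\<^sub>F n in sequentially. u n + v n \<in> dual_domain r0"
    by (rule eventually_in_dual_domain) (simp add: nn)
  have "\<forall>\<^sub>F n in sequentially.
      norm (dual_function \<alpha> (u n + v n)) \<le> dual_function \<alpha> (u n) + dual_function \<alpha> (v n)"
    using dom
    by eventually_elim (use nn dual_function_add[OF o] dual_function_nonneg[OF o] in auto)
  moreover have "summable (\<lambda>n. dual_function \<alpha> (u n) + dual_function \<alpha> (v n))"
    using u v by (intro summable_add) (auto simp: dual_in_l1_iff)
  ultimately have "summable (\<lambda>n. dual_function \<alpha> (u n + v n))"
    by (rule summable_comparison_test_ev)
  then show ?thesis using dom by (simp add: dual_in_l1_iff)
qed

text \<open>Weierstrass M-test with majorant c \<beta>(u_n). The start index is chosen for c u_n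
  alone, hence is uniform in z; the domain is closed downwards, so it serves every
  \<open>w n z\<close>.\<close>

lemma dual_series_dominated:
  assumes o: "order_function r0 \<alpha>" and u: "dual_in_l1 r0 \<alpha> u" and nn: "\<And>n. 0 \<le> u n"
    and c: "1 \<le> c" and w: "\<And>n z. z \<in> S \<Longrightarrow> 0 \<le> w n z" "\<And>n z. z \<in> S \<Longrightarrow> w n z \<le> c * u n"
  shows "dual_series_uniformly_convergent_on r0 \<alpha> S w"
proof -
  have r0: "0 \<le> r0" using o by (simp add: order_function_def)
  have "(\<lambda>n. c * u n) \<longlonglongrightarrow> 0"
    by (intro summable_LIMSEQ_zero summable_mult dual_in_l1_imp_summable[OF o] u)
  then have "\<forall>\<^sub>F n in sequentially. c * u n \<in> dual_domain r0"
    by (rule eventually_in_dual_domain) (use nn c in auto)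
  then obtain N where N: "\<And>n. N \<le> n \<Longrightarrow> c * u n \<in> dual_domain r0"
    by (auto simp: eventually_sequentially)
  have dom: "w n z \<in> dual_domain r0" if "N \<le> n" "z \<in> S" for n z
    using dual_domain_downward[OF r0 w N] that by blast
  have bd: "norm (dual_function \<alpha> (w (n + N) z)) \<le> c * dual_function \<alpha> (u (n + N))"
    if "z \<in> S" for n z
  proof -
    have "dual_function \<alpha> (w (n + N) z) \<le> dual_function \<alpha> (c * u (n + N))"
      using w that N by (intro dual_function_mono[OF o]) auto
    also have "\<dots> \<le> c * dual_function \<alpha> (u (n + N))"
      using c nn N by (intro dual_function_mult[OF o]) auto
    finally show ?thesis using dual_function_nonneg[OF o dom[of "n + N" z]] that by simp
  qed
  have "summable (\<lambda>n. c * dual_function \<alpha> (u (n + N)))"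
    using u by (intro summable_mult)
      (simp add: dual_in_l1_iff summable_iff_shift[of "\<lambda>n. dual_function \<alpha> (u n)"])
  then have "uniformly_convergent_on S (\<lambda>m z. \<Sum>n<m. dual_function \<alpha> (w (n + N) z))"
    by (rule Weierstrass_m_test'[OF bd, rotated])
  then show ?thesis using dom unfolding dual_series_uniformly_convergent_on_def by blast
qed

lemma dual_in_l1_at_point:
  assumes "dual_series_uniformly_convergent_on r0 \<alpha> S w" "z \<in> S"
  shows "dual_in_l1 r0 \<alpha> (\<lambda>n. w n z)"
proof -
  obtain N where N: "\<forall>n\<ge>N. \<forall>z\<in>S. w n z \<in> dual_domain r0"
      "uniformly_convergent_on S (\<lambda>m z. \<Sum>n<m. dual_function \<alpha> (w (n + N) z))"
    using assms(1) by (auto simp: dual_series_uniformly_convergent_on_def)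
  have "convergent (\<lambda>m. \<Sum>n<m. dual_function \<alpha> (w (n + N) z))"
    using uniformly_convergent_imp_convergent[OF N(2) assms(2)] .
  then show ?thesis using N(1) assms(2) by (auto simp: dual_in_l1_def summable_iff_convergent)
qed

lemma dual_in_l1_dominated:
  assumes "order_function r0 \<alpha>" "dual_in_l1 r0 \<alpha> u" "1 \<le> c"
    and "\<And>n. 0 \<le> w n" "\<And>n. w n \<le> c * u n" "\<And>n. 0 \<le> u n"
  shows "dual_in_l1 r0 \<alpha> w"
  using dual_in_l1_at_point[OF dual_series_dominated[where S = "{0}" and w = "\<lambda>n z. w n"]] assms
  by blast

section \<open>Growth of the products of 1 + r u_k\<close>

lemma ln_one_plus_le_dual_function:
  assumes o: "order_function r0 \<alpha>" and u: "u \<in> dual_domain r0" "u \<le> 1"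
    and r: "r0 < r" "exp 1 \<le> r"
  shows "ln (1 + r * u) \<le> 2 * (\<alpha> r * ln r) * dual_function \<alpha> u"
proof (cases "u = 0")
  case True
  then show ?thesis by (simp add: dual_function_def)
next
  case False
  then have u0: "0 < u" using u by (auto simp: dual_domain_def)
  have r0: "0 \<le> r0" and pos: "\<And>r. r0 < r \<Longrightarrow> 0 < \<alpha> r" and mono: "mono_on {r0<..} \<alpha>"
    and mono': "mono_on {r0<..} (\<lambda>r. r / \<alpha> r)"
    using o by (auto simp: order_function_def)
  have d: "r0 < 1 / u" using mem_dual_domain_iff r0 u(1) u0 by blast
  have b: "dual_function \<alpha> u = 1 / \<alpha> (1 / u)" using u0 by (simp add: dual_function_def)
  have ap: "0 < \<alpha> (1 / u)" "0 < \<alpha> r" using pos d r by auto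
  have r2: "2 \<le> r" using r(2) exp_ge_add_one_self[of 1] by linarith
  have lr: "1 \<le> ln r" using r(2) r2 by (subst ln_ge_iff) auto
  \<comment> \<open>If \<open>r u \<le> 1\<close>, monotonicity of \<open>r / \<alpha> r\<close> gives \<open>r u \<le> \<alpha>(r) \<beta>(u)\<close>; otherwise monotonicity of \<open>\<alpha>\<close>
    gives \<open>1 \<le> \<alpha>(r) \<beta>(u)\<close>, and \<open>1 + r u \<le> r\<^sup>2\<close>.\<close>
  show ?thesis
  proof (cases "r \<le> 1 / u")
    case True
    have "r / \<alpha> r \<le> (1 / u) / \<alpha> (1 / u)"
      using mono_onD[OF mono' _ _ True] d r by auto
    then have "r * u \<le> \<alpha> r * dual_function \<alpha> u"
      using u0 ap by (simp add: b field_simps)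
    moreover have "ln (1 + r * u) \<le> r * u" using u0 r2 by (intro ln_add_one_self_le_self) auto
    moreover have "\<alpha> r * dual_function \<alpha> u * 1 \<le> \<alpha> r * dual_function \<alpha> u * (2 * ln r)"
      using lr ap by (intro mult_left_mono) (auto simp: b)
    ultimately show ?thesis by (simp add: algebra_simps)
  next
    case False
    then have "\<alpha> (1 / u) \<le> \<alpha> r" using mono_onD[OF mono, of "1 / u" r] d r by auto
    then have one: "1 \<le> \<alpha> r * dual_function \<alpha> u" using ap by (simp add: b)
    have "1 + r * u \<le> r + r" using r2 u(2) u0 mult_left_mono[of u 1 r] by linarith
    also have "\<dots> \<le> r * r" using r2 mult_right_mono[of 2 r r] by linarith
    finally have "ln (1 + r * u) \<le> ln (r * r)" using u0 r2 by (subst ln_le_cancel_iff) (auto intro: add_pos_pos)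
    also have "\<dots> = 2 * ln r" using r2 by (simp add: ln_mult)
    also have "\<dots> * 1 \<le> 2 * ln r * (\<alpha> r * dual_function \<alpha> u)"
      using lr one by (intro mult_left_mono) auto
    finally show ?thesis by (simp add: algebra_simps)
  qed
qed

text \<open>Taking logarithms, each factor contributes at most g_k \<alpha>(r) ln r with g summable
  and independent of r, so K can be the sum of g for all partial products at once.\<close>

lemma prod_le_powr_order_function:
  assumes o: "order_function r0 \<alpha>" and u: "dual_in_l1 r0 \<alpha> u" and nn: "\<And>n. 0 \<le> u n"
  shows "\<exists>K. \<forall>\<^sub>F r in at_top. \<forall>n. (\<Prod>k<n. 1 + r * u k) \<le> r powr (K * \<alpha> r)"
proof -
  have lim: "filterlim \<alpha> at_top at_top" using o by (simp add: order_function_def)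
  have sm: "summable (\<lambda>n. dual_function \<alpha> (u n))" and
    dom: "\<forall>\<^sub>F n in sequentially. u n \<in> dual_domain r0"
    using u by (auto simp: dual_in_l1_iff)
  have "\<forall>\<^sub>F n in sequentially. u n < 1"
    using summable_LIMSEQ_zero[OF dual_in_l1_imp_summable[OF o u]] by (rule order_tendstoD) simp
  with dom have "\<forall>\<^sub>F n in sequentially. u n \<in> dual_domain r0 \<and> u n < 1"
    by eventually_elim simp
  then obtain N where N: "\<And>n. N \<le> n \<Longrightarrow> u n \<in> dual_domain r0 \<and> u n < 1"
    by (auto simp: eventually_sequentially)
  \<comment> \<open>For k < N, where u_k may be large or outside the domain, 1 + r u \<le> r (1 + u)
    gives ln (1 + r u) \<le> (1 + ln (1 + u)) ln r, and \<alpha>(r) \<ge> 1 does the rest. The later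
    terms come from \<open>ln_one_plus_le_dual_function\<close>.\<close>
  define g where "g n = (if n < N then 1 + ln (1 + u n) else 2 * dual_function \<alpha> (u n))" for n
  have g0: "0 \<le> g n" for n
    using nn N dual_function_nonneg[OF o] by (auto simp: g_def not_less)
  have sg: "summable g"
  proof (rule summable_comparison_test_ev[OF _ summable_mult[OF sm, of 2]])
    show "\<forall>\<^sub>F n in sequentially. norm (g n) \<le> 2 * dual_function \<alpha> (u n)"
      using eventually_ge_at_top[of N]
      by eventually_elim (use N dual_function_nonneg[OF o] in \<open>auto simp: g_def\<close>)
  qed
  have "\<forall>\<^sub>F r in at_top. 1 \<le> \<alpha> r" using lim by (auto simp: filterlim_at_top)
  moreover have "\<forall>\<^sub>F r in at_top. max (r0 + 1) (exp 1) \<le> r" by (rule eventually_ge_at_top)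
  ultimately have "\<forall>\<^sub>F r in at_top. \<forall>n. (\<Prod>k<n. 1 + r * u k) \<le> r powr (suminf g * \<alpha> r)"
  proof eventually_elim
    case (elim r)
    have r: "r0 < r" "exp 1 \<le> r" "1 \<le> \<alpha> r" using elim by auto
    have r2: "2 \<le> r" using r(2) exp_ge_add_one_self[of 1] by linarith
    have lr: "1 \<le> ln r" using r(2) r2 by (subst ln_ge_iff) auto
    have pos: "0 < 1 + r * u k" for k
      using nn[of k] r2 by (simp add: add_pos_nonneg)
    have le: "ln (1 + r * u k) \<le> g k * (\<alpha> r * ln r)" for k
    proof (cases "k < N")
      case True
      have "1 + r * u k \<le> r * (1 + u k)" using r2 by (simp add: algebra_simps)
      then have "ln (1 + r * u k) \<le> ln (r * (1 + u k))"
        using pos[of k] nn[of k] r2 by (subst ln_le_cancel_iff) (auto simp: add_pos_nonneg)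
      also have "\<dots> = ln r + 1 * ln (1 + u k)"
        using nn[of k] r2 by (simp add: ln_mult add_pos_nonneg)
      also have "\<dots> \<le> ln r + ln r * ln (1 + u k)"
        using lr nn[of k] by (intro add_left_mono mult_right_mono) auto
      also have "\<dots> = 1 * (ln r * g k)" using True by (simp add: g_def algebra_simps)
      also have "\<dots> \<le> \<alpha> r * (ln r * g k)" using r(3) lr g0 by (intro mult_right_mono) auto
      finally show ?thesis by (simp add: algebra_simps)
    next
      case False
      then show ?thesis
        using ln_one_plus_le_dual_function[OF o, of "u k" r] N[of k] r
        by (simp add: g_def algebra_simps)
    qed
    show ?case
    proof
      fix n
      have "(\<Prod>k<n. 1 + r * u k) = exp (\<Sum>k<n. ln (1 + r * u k))"
        using pos by (simp add: exp_sum)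
      also have "(\<Sum>k<n. ln (1 + r * u k)) \<le> (\<Sum>k<n. g k) * (\<alpha> r * ln r)"
        unfolding sum_distrib_right by (intro sum_mono le)
      also have "\<dots> \<le> suminf g * (\<alpha> r * ln r)"
        using sg g0 r lr by (intro mult_right_mono sum_le_suminf) auto
      also have "exp \<dots> = r powr (suminf g * \<alpha> r)" using r2 by (simp add: powr_def)
      finally show "(\<Prod>k<n. 1 + r * u k) \<le> r powr (suminf g * \<alpha> r)" by simp
    qed
  qed
  then show ?thesis by blast
qed

text \<open>This bound gives the locally uniform estimates; the order of P rests on
  \<open>prod_le_powr_order_function\<close>.\<close>

lemma prod_one_plus_le_exp_suminf:
  fixes u :: "nat \<Rightarrow> real"
  assumes "summable u" "\<And>n. 0 \<le> u n" "0 \<le> r"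
  shows "(\<Prod>k<n. 1 + r * u k) \<le> exp (r * suminf u)"
proof -
  have "(\<Prod>k<n. 1 + r * u k) \<le> (\<Prod>k<n. exp (r * u k))"
    using assms by (intro prod_mono) auto
  also have "\<dots> = exp (r * (\<Sum>k<n. u k))" by (simp add: exp_sum sum_distrib_left)
  also have "\<dots> \<le> exp (r * suminf u)"
    using assms by (auto intro!: mult_left_mono sum_le_suminf)
  finally show ?thesis .
qed

section \<open>Solutions of the recurrence and their Wronskian\<close>

lemma cpoly_0 [simp]: "cpoly 0 z = 0"
  by (simp add: cpoly_def)

lemma cpoly_pCons [simp]: "cpoly (pCons c p) z = of_real c + z * cpoly p z"
  by (simp add: cpoly_def map_poly_pCons)

lemma cpoly_1 [simp]: "cpoly 1 z = 1"
  by (simp add: cpoly_def)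

lemma cpoly_minus_1 [simp]: "cpoly (- 1) z = - 1"
  using cpoly_pCons[of "- 1" 0 z] by (simp add: one_pCons)

lemma cpoly_add [simp]: "cpoly (p + q) z = cpoly p z + cpoly q z"
  by (induction p q rule: poly_induct2) (auto simp: algebra_simps)

lemma cpoly_smult [simp]: "cpoly (smult c p) z = of_real c * cpoly p z"
  by (induction p) (auto simp: algebra_simps)

lemma cpoly_at_0: "cpoly p 0 = of_real (poly p 0)"
  by (cases p) simp

lemma continuous_on_cpoly: "continuous_on S (cpoly p)"
  unfolding cpoly_def by (intro continuous_intros)

text \<open>Index 0 is separate because r_{-1} is the parameter \<open>q\<close>, with coefficient
  b_{-1} = 1, rather than an entry of the sequence.\<close>

lemma three_term_recurrence_cpoly:
  assumes "three_term_recurrence a b q r"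
  shows "of_real (b 0) * cpoly (r 1) z = (z - of_real (a 0)) * cpoly (r 0) z - cpoly q z"
    and "of_real (b (Suc n)) * cpoly (r (Suc (Suc n))) z =
      (z - of_real (a (Suc n))) * cpoly (r (Suc n)) z - of_real (b n) * cpoly (r n) z"
proof -
  have rec: "[:0, 1:] * r n = smult (b n) (r (Suc n)) + smult (a n) (r n) +
        (case n of 0 \<Rightarrow> q | Suc m \<Rightarrow> smult (b m) (r m))" for n
    using assms by (simp add: three_term_recurrence_def)
  show "of_real (b 0) * cpoly (r 1) z = (z - of_real (a 0)) * cpoly (r 0) z - cpoly q z"
    using arg_cong[OF rec[of 0], of "\<lambda>p. cpoly p z"] by (simp add: algebra_simps)
  show "of_real (b (Suc n)) * cpoly (r (Suc (Suc n))) z =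
      (z - of_real (a (Suc n))) * cpoly (r (Suc n)) z - of_real (b n) * cpoly (r n) z"
    using arg_cong[OF rec[of "Suc n"], of "\<lambda>p. cpoly p z"] by (simp add: algebra_simps)
qed

lemma three_term_recurrence_poly_0:
  assumes "three_term_recurrence a b q r"
  shows "b 0 * poly (r 1) 0 = - a 0 * poly (r 0) 0 - poly q 0"
    and "b (Suc n) * poly (r (Suc (Suc n))) 0 =
      - a (Suc n) * poly (r (Suc n)) 0 - b n * poly (r n) 0"
proof -
  have "complex_of_real (b 0 * poly (r 1) 0) = of_real (- a 0 * poly (r 0) 0 - poly q 0)"
    using three_term_recurrence_cpoly(1)[OF assms, of 0] by (simp add: cpoly_at_0)
  then show "b 0 * poly (r 1) 0 = - a 0 * poly (r 0) 0 - poly q 0"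
    unfolding of_real_eq_iff .
  have "complex_of_real (b (Suc n) * poly (r (Suc (Suc n))) 0) =
      of_real (- a (Suc n) * poly (r (Suc n)) 0 - b n * poly (r n) 0)"
    using three_term_recurrence_cpoly(2)[OF assms, of n 0] by (simp add: cpoly_at_0)
  then show "b (Suc n) * poly (r (Suc (Suc n))) 0 =
      - a (Suc n) * poly (r (Suc n)) 0 - b n * poly (r n) 0"
    unfolding of_real_eq_iff .
qed

text \<open>Both sequences solve the recurrence at the same point 0, so the a_n terms cancel and the
  expression is independent of n; at n = 0 it is b_0 Q_1(0) = 1.\<close>

lemma wronskian_at_0:
  assumes P: "three_term_recurrence a b 0 P" and "P 0 = 1"
    and Q: "three_term_recurrence a b (- 1) Q" and "Q 0 = 0"
  shows "b n * (poly (P n) 0 * poly (Q (Suc n)) 0 - poly (P (Suc n)) 0 * poly (Q n) 0) = 1"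
proof (induction n)
  case 0
  then show ?case using three_term_recurrence_poly_0(1)[OF Q] assms by simp
next
  case (Suc n)
  have "b (Suc n) * (poly (P (Suc n)) 0 * poly (Q (Suc (Suc n))) 0
      - poly (P (Suc (Suc n))) 0 * poly (Q (Suc n)) 0)
    = poly (P (Suc n)) 0 * (b (Suc n) * poly (Q (Suc (Suc n))) 0)
      - (b (Suc n) * poly (P (Suc (Suc n))) 0) * poly (Q (Suc n)) 0"
    by (simp add: algebra_simps)
  also have "\<dots> = b n * (poly (P n) 0 * poly (Q (Suc n)) 0 - poly (P (Suc n)) 0 * poly (Q n) 0)"
    unfolding three_term_recurrence_poly_0(2)[OF P] three_term_recurrence_poly_0(2)[OF Q]
    by (simp add: algebra_simps)
  finally show ?case using Suc by simp
qed

section \<open>Variation of constants\<close>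

text \<open>Triangle inequality followed by Cauchy-Schwarz in the plane; \<open>norm (A, B)\<close>
  is the Euclidean norm of the pair.\<close>

lemma norm_real_combination_le:
  fixes A B :: complex and p q :: real
  shows "norm (of_real p * A + of_real q * B) \<le> sqrt (p\<^sup>2 + q\<^sup>2) * norm (A, B)"
proof -
  have "norm (of_real p * A + of_real q * B) \<le> \<bar>p\<bar> * norm A + \<bar>q\<bar> * norm B"
    using norm_triangle_ineq[of "of_real p * A" "of_real q * B"] by (simp add: norm_mult)
  also have "\<dots> \<le> sqrt ((p\<^sup>2 + q\<^sup>2) * ((norm A)\<^sup>2 + (norm B)\<^sup>2))"
  proof (rule real_le_rsqrt)
    have "0 \<le> (\<bar>p\<bar> * norm B - \<bar>q\<bar> * norm A)\<^sup>2" by simp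
    then have "(\<bar>p\<bar> * norm A + \<bar>q\<bar> * norm B)\<^sup>2 \<le> (\<bar>p\<bar>\<^sup>2 + \<bar>q\<bar>\<^sup>2) * ((norm A)\<^sup>2 + (norm B)\<^sup>2)"
      by (simp add: power2_eq_square algebra_simps del: abs_mult_self_eq)
    then show "(\<bar>p\<bar> * norm A + \<bar>q\<bar> * norm B)\<^sup>2 \<le> (p\<^sup>2 + q\<^sup>2) * ((norm A)\<^sup>2 + (norm B)\<^sup>2)"
      by simp
  qed
  finally show ?thesis by (simp add: real_sqrt_mult norm_Pair)
qed

text \<open>Keeping the solution \<open>R\<close> and its value \<open>e\<close> at index -1 general
  covers P and Q together. The pair in \<open>init\<close> is (A_0, B_0), and 1 + |z| is the factor
  k = 0 of the product, since u_0 = 1.\<close>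

lemma cpoly_solution_bound:
  assumes P: "three_term_recurrence a b 0 P" and P0: "P 0 = 1"
    and Q: "three_term_recurrence a b (- 1) Q" and Q0: "Q 0 = 0"
    and R: "three_term_recurrence a b e R"
    and init: "norm (cpoly (R 0) z, z * cpoly (R 0) z - cpoly e z) \<le> 1 + cmod z"
  defines "u \<equiv> \<lambda>n. (poly (P n) 0)\<^sup>2 + (poly (Q n) 0)\<^sup>2"
  shows "cmod (cpoly (R n) z) \<le> sqrt (u n) * (\<Prod>k<Suc n. 1 + cmod z * u k)"
proof -
  define p q where "p n = poly (P n) 0" and "q n = poly (Q n) 0" for n
  define r where "r n = cpoly (R n) z" for n
  define A where
    "A n = of_real (b n) * (r n * of_real (q (Suc n)) - r (Suc n) * of_real (q n))" for n
  define B where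
    "B n = of_real (b n) * (of_real (p n) * r (Suc n) - of_real (p (Suc n)) * r n)" for n
  have u: "u n = (p n)\<^sup>2 + (q n)\<^sup>2" for n by (simp add: u_def p_def q_def)
  have p0: "p 0 = 1" and q0: "q 0 = 0" by (simp_all add: p_def q_def P0 Q0)
  have p1: "b 0 * p 1 = - a 0" and q1: "b 0 * q 1 = 1"
    using three_term_recurrence_poly_0(1)[OF P] three_term_recurrence_poly_0(1)[OF Q] P0 Q0
    by (simp_all add: p_def q_def)
  have pS: "of_real (b (Suc n)) * of_real (p (Suc (Suc n))) =
      (- of_real (a (Suc n)) * of_real (p (Suc n)) - of_real (b n) * of_real (p n) :: complex)" for n
    using three_term_recurrence_cpoly(2)[OF P, of n 0] by (simp add: p_def cpoly_at_0)
  have qS: "of_real (b (Suc n)) * of_real (q (Suc (Suc n))) =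
      (- of_real (a (Suc n)) * of_real (q (Suc n)) - of_real (b n) * of_real (q n) :: complex)" for n
    using three_term_recurrence_cpoly(2)[OF Q, of n 0] by (simp add: q_def cpoly_at_0)
  have rS: "of_real (b (Suc n)) * r (Suc (Suc n)) =
      (z - of_real (a (Suc n))) * r (Suc n) - of_real (b n) * r n" for n
    using three_term_recurrence_cpoly(2)[OF R] by (simp add: r_def)
  have W: "b n * (p n * q (Suc n) - p (Suc n) * q n) = 1" for n
    using wronskian_at_0[OF P P0 Q Q0] by (simp add: p_def q_def)
  have W': "of_real (b n) * (of_real (p n) * of_real (q (Suc n))
      - of_real (p (Suc n)) * of_real (q n)) = (1 :: complex)" for n
    using arg_cong[OF W[of n], of complex_of_real] by simp
  \<comment> \<open>Cramer's rule with determinant 1/b_n: one pair (A_n, B_n) reproduces r at both n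
    and n+1.\<close>
  have rep: "r n = of_real (p n) * A n + of_real (q n) * B n"
    and rep': "r (Suc n) = of_real (p (Suc n)) * A n + of_real (q (Suc n)) * B n" for n
    unfolding A_def B_def using W'[of n] by algebra+
  \<comment> \<open>The sequences p, q solve the recurrence at 0 and r at z, so everything cancels
    except the term with z r_{n+1}.\<close>
  have AS: "A (Suc n) = A n - z * r (Suc n) * of_real (q (Suc n))" for n
    unfolding A_def using qS[of n] rS[of n] by algebra
  have BS: "B (Suc n) = B n + z * r (Suc n) * of_real (p (Suc n))" for n
    unfolding B_def using pS[of n] rS[of n] by algebra
  have rn: "cmod (r n) \<le> sqrt (u n) * norm (A n, B n)"
    and rn': "cmod (r (Suc n)) \<le> sqrt (u (Suc n)) * norm (A n, B n)" for n
    unfolding u by (subst rep rep', rule norm_real_combination_le)+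
  have AB: "norm (A n, B n) \<le> (\<Prod>k<Suc n. 1 + cmod z * u k)" for n
  proof (induction n)
    case 0
    have "complex_of_real (b 0) * of_real (q 1) = 1"
      using arg_cong[OF q1, of complex_of_real] by simp
    then have "A 0 = r 0" by (simp add: A_def q0 algebra_simps)
    moreover have "complex_of_real (b 0) * of_real (p 1) = - of_real (a 0)"
      using arg_cong[OF p1, of complex_of_real] by simp
    then have "B 0 = z * r 0 - cpoly e z"
      using three_term_recurrence_cpoly(1)[OF R, of z] unfolding B_def p0 r_def[symmetric]
      by (simp add: algebra_simps)
    ultimately show ?case using init by (simp add: u p0 q0 r_def)
  next
    case (Suc n)
    have split: "(A (Suc n), B (Suc n)) =
        (A n, B n) + (- z * r (Suc n) * of_real (q (Suc n)), z * r (Suc n) * of_real (p (Suc n)))"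
      by (simp add: AS BS)
    \<comment> \<open>The increment is z r_{n+1} times (-q_{n+1}, p_{n+1}), a vector of length sqrt
      u_{n+1}. Bounding r_{n+1} by the old pair through \<open>rn'\<close> supplies the second
      factor sqrt u_{n+1}.\<close>
    have "norm (- z * r (Suc n) * of_real (q (Suc n)), z * r (Suc n) * of_real (p (Suc n)))
      = sqrt ((cmod z * cmod (r (Suc n)))\<^sup>2 * u (Suc n))"
      by (simp add: norm_Pair norm_mult u power_mult_distrib algebra_simps)
    also have "\<dots> = cmod z * (cmod (r (Suc n)) * sqrt (u (Suc n)))"
      by (simp add: real_sqrt_mult)
    also have "\<dots> \<le> cmod z * (sqrt (u (Suc n)) * norm (A n, B n) * sqrt (u (Suc n)))"
      using rn'[of n] by (intro mult_left_mono mult_right_mono) (auto simp: u)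
    also have "\<dots> = cmod z * u (Suc n) * norm (A n, B n)"
      by (simp add: u)
    finally have "norm (A (Suc n), B (Suc n)) \<le> (1 + cmod z * u (Suc n)) * norm (A n, B n)"
      unfolding split
      using norm_triangle_ineq[of "(A n, B n)"
        "(- z * r (Suc n) * of_real (q (Suc n)), z * r (Suc n) * of_real (p (Suc n)))"]
      by (simp add: algebra_simps)
    also have "\<dots> \<le> (1 + cmod z * u (Suc n)) * (\<Prod>k<Suc n. 1 + cmod z * u k)"
      using Suc by (intro mult_left_mono) (auto simp: u)
    finally show ?case by (simp add: mult.commute mult.left_commute)
  qed
  show ?thesis
    using rn[of n] mult_left_mono[OF AB[of n], of "sqrt (u n)"] by (simp add: r_def u)
qed

section \<open>Maximum modulus and unboundedness\<close>

lemma max_modulus_le: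
  assumes "0 \<le> r" "\<And>z. cmod z \<le> r \<Longrightarrow> cmod (f z) \<le> m"
  shows "max_modulus f r \<le> m"
  unfolding max_modulus_def using assms by (intro cSUP_least) auto

lemma not_bounded_range_if_linear_lower_bound:
  fixes f :: "complex \<Rightarrow> complex"
  assumes "0 < c" "\<And>z. c * cmod (z - w) \<le> cmod (f z)"
  shows "\<not> bounded (range f)"
proof
  assume "bounded (range f)"
  then obtain M where M: "\<And>z. cmod (f z) \<le> M" by (auto simp: bounded_iff)
  \<comment> \<open>At distance (|M| + 1)/c from w the lower bound is |M| + 1, which exceeds
    M.\<close>
  have "c * cmod (w + of_real ((\<bar>M\<bar> + 1) / c) - w) \<le> M"
    by (rule order_trans[OF assms(2) M])
  then have "c * \<bar>(\<bar>M\<bar> + 1) / c\<bar> \<le> M" by (simp only: add_diff_cancel_left' norm_of_real)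
  then show False using assms(1) by simp
qed

section \<open>Equivalence, uniform convergence and the order of P\<close>

theorem theorem5p8:
  fixes r0 :: real and \<alpha> :: "real \<Rightarrow> real"
    and \<mu> :: "real measure" and s :: "nat \<Rightarrow> real"
    and a b :: "nat \<Rightarrow> real" and P Q :: "nat \<Rightarrow> real poly"
  assumes "order_function r0 \<alpha>"
    and "normalized_hamburger \<mu> s"
    and "indeterminate s"
    and "orthonormal_polynomials \<mu> P"
    and "\<forall>n. 0 < b n"
    and "three_term_recurrence a b 0 P" and "P 0 = 1"
    and "three_term_recurrence a b (- 1) Q" and "Q 0 = 0"
  defines "cond_i \<equiv>
      dual_in_l1 r0 \<alpha> (\<lambda>n. (poly (P n) 0)\<^sup>2) \<and> dual_in_l1 r0 \<alpha> (\<lambda>n. (poly (Q n) 0)\<^sup>2)"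
    and "cond_ii \<equiv>
      (\<forall>z::complex. dual_in_l1 r0 \<alpha> (\<lambda>n. (cmod (cpoly (P n) z))\<^sup>2) \<and>
                    dual_in_l1 r0 \<alpha> (\<lambda>n. (cmod (cpoly (Q n) z))\<^sup>2))"
  shows "(cond_i \<longleftrightarrow> cond_ii) \<and>
    (cond_i \<longrightarrow>
      (\<forall>C. compact C \<longrightarrow>
         dual_series_uniformly_convergent_on r0 \<alpha> C (\<lambda>n z. (cmod (cpoly (P n) z))\<^sup>2) \<and>
         dual_series_uniformly_convergent_on r0 \<alpha> C (\<lambda>n z. (cmod (cpoly (Q n) z))\<^sup>2)) \<and>
      dual_in_l1 r0 \<alpha> (\<lambda>n. 1 / b n) \<and>
      has_order_bounded_by (\<lambda>z. complex_of_real (P_function P z)) \<alpha>)"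
proof -
  note o = assms(1) and b = assms(5) and P = assms(6) and P0 = assms(7) and Q = assms(8)
    and Q0 = assms(9)
  define u where "u n = (poly (P n) 0)\<^sup>2 + (poly (Q n) 0)\<^sup>2" for n
  have u0: "0 \<le> u n" for n by (simp add: u_def)
  \<comment> \<open>The initial pair is (1, z) for P and (0, 1) for Q; both have norm at most 1 +
    |z|.\<close>
  have boundP: "cmod (cpoly (P n) z) \<le> sqrt (u n) * (\<Prod>k<Suc n. 1 + cmod z * u k)" for n z
    unfolding u_def
    using norm_Pair_le[of "1::complex" z] by (intro cpoly_solution_bound[OF P P0 Q Q0 P]) (simp add: P0)
  have boundQ: "cmod (cpoly (Q n) z) \<le> sqrt (u n) * (\<Prod>k<Suc n. 1 + cmod z * u k)" for n z
    unfolding u_def by (intro cpoly_solution_bound[OF P P0 Q Q0 Q]) (simp add: Q0 norm_Pair)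
  have sq: "x\<^sup>2 \<le> c\<^sup>2 * u n"
    if "x \<le> sqrt (u n) * (\<Prod>k<Suc n. 1 + cmod z * u k)" "0 \<le> x"
      "(\<Prod>k<Suc n. 1 + cmod z * u k) \<le> c" for x c n z
  proof -
    have "x \<le> sqrt (u n) * c"
      using that u0[of n] by (meson mult_left_mono order_trans real_sqrt_ge_zero)
    then have "x\<^sup>2 \<le> (sqrt (u n) * c)\<^sup>2" using that(2) by (rule power_mono)
    then show ?thesis using u0 by (simp add: power_mult_distrib mult.commute)
  qed
  \<comment> \<open>Everything is derived from (i); the implication from (ii) to (i) is the case z =
    0.\<close>
  have main: "cond_ii \<and> (\<forall>C. compact C \<longrightarrow>
         dual_series_uniformly_convergent_on r0 \<alpha> C (\<lambda>n z. (cmod (cpoly (P n) z))\<^sup>2) \<and>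
         dual_series_uniformly_convergent_on r0 \<alpha> C (\<lambda>n z. (cmod (cpoly (Q n) z))\<^sup>2)) \<and>
      dual_in_l1 r0 \<alpha> (\<lambda>n. 1 / b n) \<and>
      has_order_bounded_by (\<lambda>z. complex_of_real (P_function P z)) \<alpha>" if cond_i
  proof -
    have lu: "dual_in_l1 r0 \<alpha> u"
      using \<open>cond_i\<close> unfolding cond_i_def u_def by (intro dual_in_l1_add[OF o]) auto
    note su = dual_in_l1_imp_summable[OF o lu]
    \<comment> \<open>Bounded rather than compact sets, so that the open balls in the continuity
      proof are covered too.\<close>
    have local_bound: "\<exists>c\<ge>1. \<forall>z\<in>S. \<forall>n.
        (cmod (cpoly (P n) z))\<^sup>2 \<le> c * u n \<and> (cmod (cpoly (Q n) z))\<^sup>2 \<le> c * u n"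
      if "bounded S" for S
    proof -
      obtain R where R: "0 < R" "\<forall>z\<in>S. cmod z \<le> R"
        using \<open>bounded S\<close> by (auto simp: bounded_pos)
      define c where "c = exp (R * suminf u)"
      have "1 \<le> c" using R(1) suminf_nonneg[OF su u0] by (simp add: c_def)
      moreover have "(\<Prod>k<n. 1 + cmod z * u k) \<le> c" if "z \<in> S" for n z
      proof -
        have "(\<Prod>k<n. 1 + cmod z * u k) \<le> exp (cmod z * suminf u)"
          by (rule prod_one_plus_le_exp_suminf[OF su u0]) simp
        also have "\<dots> \<le> c"
          using bspec[OF R(2) that] suminf_nonneg[OF su u0] by (simp add: c_def mult_right_mono)
        finally show ?thesis .
      qed
      ultimately show ?thesis
        using sq[OF boundP] sq[OF boundQ] by (intro exI[of _ "c\<^sup>2"]) (simp add: one_le_power del: prod.lessThan_Suc)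
    qed
    have unif: "dual_series_uniformly_convergent_on r0 \<alpha> C (\<lambda>n z. (cmod (cpoly (P n) z))\<^sup>2) \<and>
         dual_series_uniformly_convergent_on r0 \<alpha> C (\<lambda>n z. (cmod (cpoly (Q n) z))\<^sup>2)"
      if "compact C" for C
    proof -
      obtain c where "1 \<le> c" "\<forall>z\<in>C. \<forall>n.
          (cmod (cpoly (P n) z))\<^sup>2 \<le> c * u n \<and> (cmod (cpoly (Q n) z))\<^sup>2 \<le> c * u n"
        using local_bound compact_imp_bounded[OF \<open>compact C\<close>] by blast
      then show ?thesis
        by (intro conjI dual_series_dominated[OF o lu u0]) auto
    qed
    have "cond_ii"
      unfolding cond_ii_def
    proof (intro allI conjI)
      fix z :: complex
      show "dual_in_l1 r0 \<alpha> (\<lambda>n. (cmod (cpoly (P n) z))\<^sup>2)"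
        by (rule dual_in_l1_at_point[OF conjunct1[OF unif[of "{z}"]]]) auto
      show "dual_in_l1 r0 \<alpha> (\<lambda>n. (cmod (cpoly (Q n) z))\<^sup>2)"
        by (rule dual_in_l1_at_point[OF conjunct2[OF unif[of "{z}"]]]) auto
    qed
    moreover have "dual_in_l1 r0 \<alpha> (\<lambda>n. 1 / b n)"
    proof (rule dual_in_l1_dominated[OF o dual_in_l1_add[OF o lu dual_in_l1_Suc[OF lu]], of 1])
      fix n
      define p p' q q' where
        "p = poly (P n) 0" and "p' = poly (P (Suc n)) 0" and
        "q = poly (Q n) 0" and "q' = poly (Q (Suc n)) 0"
      have "1 / b n = p * q' - p' * q"
        using wronskian_at_0[OF P P0 Q Q0, of n] b[rule_format, of n]
        by (simp add: p_def p'_def q_def q'_def field_simps)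
      also have "\<dots> \<le> (p\<^sup>2 + q'\<^sup>2) + (p'\<^sup>2 + q\<^sup>2)"
      proof -
        \<comment> \<open>The first two squares bound p q' and -p' q by half the sums of squares;
          the other four absorb the factor 1/2.\<close>
        have "0 \<le> (p - q')\<^sup>2" "0 \<le> (p' + q)\<^sup>2" "0 \<le> p\<^sup>2" "0 \<le> q'\<^sup>2" "0 \<le> p'\<^sup>2" "0 \<le> q\<^sup>2"
          by simp_all
        then show ?thesis unfolding power2_diff power2_sum by linarith
      qed
      finally show "1 / b n \<le> 1 * (u n + u (Suc n))"
        by (simp add: u_def p_def p'_def q_def q'_def algebra_simps)
    qed (use b u0 less_imp_le in auto)
    moreover have "has_order_bounded_by (\<lambda>z. complex_of_real (P_function P z)) \<alpha>"
      unfolding has_order_bounded_by_def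
    proof (intro conjI)
      have sumP: "summable (\<lambda>n. (cmod (cpoly (P n) z))\<^sup>2)" for z
      proof -
        obtain c where "\<forall>n. (cmod (cpoly (P n) z))\<^sup>2 \<le> c * u n"
          using local_bound[of "{z}"] by auto
        then show ?thesis
          by (intro summable_comparison_test'[OF summable_mult[OF su, of c]]) auto
      qed
      \<comment> \<open>Continuity is local: on each unit ball the series converges uniformly, by
        the majorant c u_n.\<close>
      have "continuous_on UNIV (\<lambda>z. \<Sum>n. (cmod (cpoly (P n) z))\<^sup>2)"
        unfolding continuous_on_eq_continuous_at[OF open_UNIV]
      proof
        fix z :: complex
        obtain c where c: "\<forall>z\<in>ball z 1. \<forall>n. (cmod (cpoly (P n) z))\<^sup>2 \<le> c * u n"
          using local_bound[of "ball z 1"] by auto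
        have "uniform_limit (ball z 1) (\<lambda>n x. \<Sum>i<n. (cmod (cpoly (P i) x))\<^sup>2)
            (\<lambda>x. \<Sum>i. (cmod (cpoly (P i) x))\<^sup>2) sequentially"
          by (rule Weierstrass_m_test[OF _ summable_mult[OF su, of c]]) (use c in auto)
        then have "continuous_on (ball z 1) (\<lambda>x. \<Sum>i. (cmod (cpoly (P i) x))\<^sup>2)"
          by (rule uniform_limit_theorem[rotated])
            (auto intro!: always_eventually continuous_intros continuous_on_cpoly)
        then show "isCont (\<lambda>z. \<Sum>n. (cmod (cpoly (P n) z))\<^sup>2) z"
          using continuous_on_eq_continuous_at[OF open_ball] by (metis centre_in_ball zero_less_one)
      qed
      then show "continuous_on UNIV (\<lambda>z. complex_of_real (P_function P z))"
        unfolding P_function_def by (intro continuous_intros)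
      have P_nonneg: "0 \<le> P_function P z" for z
        unfolding P_function_def using suminf_nonneg[OF sumP] by simp
      \<comment> \<open>P dominates its single term |P_1(z)| = |z - a_0|/b_0, which is
        unbounded.\<close>
      have low: "(1 / b 0) * cmod (z - of_real (a 0)) \<le> cmod (complex_of_real (P_function P z))" for z
      proof -
        have "(cmod (cpoly (P 1) z))\<^sup>2 \<le> (\<Sum>n. (cmod (cpoly (P n) z))\<^sup>2)"
          using sum_le_suminf[OF sumP, of "{1}" z] by simp
        then have "cmod (cpoly (P 1) z) \<le> P_function P z"
          unfolding P_function_def by (rule real_le_rsqrt)
        moreover have "cmod (cpoly (P 1) z) = (1 / b 0) * cmod (z - of_real (a 0))"
          using arg_cong[OF three_term_recurrence_cpoly(1)[OF P, of z], of cmod]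
            b[rule_format, of 0]
          by (simp add: P0 norm_mult field_simps)
        ultimately show ?thesis using P_nonneg by simp
      qed
      show "\<not> bounded (range (\<lambda>z. complex_of_real (P_function P z)))"
        by (rule not_bounded_range_if_linear_lower_bound[OF _ low]) (use b in simp)
      obtain K where K: "\<forall>\<^sub>F r in at_top. \<forall>n. (\<Prod>k<n. 1 + r * u k) \<le> r powr (K * \<alpha> r)"
        using prod_le_powr_order_function[OF o lu u0] by blast
      have "\<forall>\<^sub>F r in at_top. 1 \<le> \<alpha> r"
        using o by (auto simp: order_function_def filterlim_at_top)
      \<comment> \<open>The extra 1 in \<open>K + 1\<close> absorbs the constant sqrt (suminf u):
        for large r it is at most r, hence at most r^\<alpha>(r), as \<alpha>(r) \<ge> 1.\<close>
      with K have "\<forall>\<^sub>F r in at_top.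
          max_modulus (\<lambda>z. complex_of_real (P_function P z)) r \<le> r powr ((K + 1) * \<alpha> r)"
        using eventually_ge_at_top[of "max 1 (sqrt (suminf u))"]
      proof eventually_elim
        case (elim r)
        define m where "m = r powr (K * \<alpha> r)"
        have r: "1 \<le> r" "sqrt (suminf u) \<le> r" "1 \<le> \<alpha> r" using elim by auto
        show ?case
        proof (rule max_modulus_le)
          fix z assume z: "cmod z \<le> r"
          have "(\<Prod>k<n. 1 + cmod z * u k) \<le> m" for n
          proof -
            have "(\<Prod>k<n. 1 + cmod z * u k) \<le> (\<Prod>k<n. 1 + r * u k)"
              using z u0 by (intro prod_mono) (auto intro: mult_right_mono)
            then show ?thesis using elim unfolding m_def by (meson order_trans)
          qed
          then have "(cmod (cpoly (P n) z))\<^sup>2 \<le> m\<^sup>2 * u n" for n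
            using sq[OF boundP norm_ge_zero] by blast
          then have "(\<Sum>n. (cmod (cpoly (P n) z))\<^sup>2) \<le> (\<Sum>n. m\<^sup>2 * u n)"
            by (intro suminf_le sumP summable_mult su)
          also have "\<dots> = m\<^sup>2 * suminf u" by (rule suminf_mult[OF su])
          finally have "P_function P z \<le> sqrt (m\<^sup>2 * suminf u)"
            unfolding P_function_def by (rule real_sqrt_le_mono)
          also have "\<dots> = m * sqrt (suminf u)" by (simp add: real_sqrt_mult m_def)
          also have "\<dots> \<le> m * r powr \<alpha> r"
          proof (intro mult_left_mono)
            show "sqrt (suminf u) \<le> r powr \<alpha> r"
              using r powr_mono[of 1 "\<alpha> r" r] by simp
          qed (simp add: m_def)
          also have "\<dots> = r powr ((K + 1) * \<alpha> r)"
            by (simp add: m_def distrib_right powr_add)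
          finally show "cmod (complex_of_real (P_function P z)) \<le> r powr ((K + 1) * \<alpha> r)"
            using P_nonneg by simp
        qed (use r in simp)
      qed
      then show "\<exists>K. \<forall>\<^sub>F r in at_top.
          max_modulus (\<lambda>z. complex_of_real (P_function P z)) r \<le> r powr (K * \<alpha> r)"
        by blast
    qed
    ultimately show ?thesis using unif by blast
  qed
  moreover have "cond_i" if "cond_ii"
    using spec[OF that[unfolded cond_ii_def], of 0] by (simp add: cond_i_def cpoly_at_0)
  ultimately show ?thesis by blast
qed

end
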